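(* Let $(a_n)_{n\ge1}$ and $(b_n)_{n\ge1}$ be sequences of positive integers and put $c_n=\frac{a_n}{b_n}>0$. Assume: (1) $b_n \mid b_{n+1}$ for all $n=1,2,\dots$; (2) $\lim_{n\to\infty} a_n\frac{c_{n+1}}{c_n}=0$. Then the series $\sum_{n=1}^{\infty}c_n$ converges to an irrational number. *)

theory Defs
  imports Complex_Main
begin

end

theory Submission
  imports Defs
begin

text \<open>
  Since \<open>a n / c n = b n\<close>, the second hypothesis says \<open>b n * c (n + 1) \<longlonglongrightarrow> 0\<close>, and, as \<open>a n \<ge> 1\<close>, it
  also makes the terms eventually decay at least geometrically with ratio \<open>1 / 2\<close>. Hence the series
  converges and its tail after \<open>c n\<close> is at most \<open>2 * c (n + 1)\<close>, so that the tail times \<open>b n\<close>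
  tends to \<open>0\<close>. By divisibility \<open>b n\<close> clears the denominators of the \<open>n\<close>-th partial sum; if the
  sum were \<open>p / q\<close>, then \<open>q * b n\<close> times the tail would be a positive integer tending to \<open>0\<close>.
\<close>

text \<open>Iterating the halving from any \<open>n \<ge> N\<close> dominates
  \<open>d (k + n)\<close> by \<open>d n * (1/2) ^ k\<close>, a geometric series with sum
  \<open>2 * d n\<close>.\<close>

lemma halving_summable_tail_le:
  fixes d :: "nat \<Rightarrow> real"
  assumes pos: "\<And>n. d n > 0" and half: "\<And>n. n \<ge> N \<Longrightarrow> d (Suc n) \<le> d n / 2"
  shows "summable d" and "n \<ge> N \<Longrightarrow> (\<Sum>k. d (k + n)) \<le> 2 * d n"
proof -
  have le: "d (k + n) \<le> d n * (1/2) ^ k" if "n \<ge> N" for n k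
  proof (induction k)
    case (Suc k)
    then show ?case using half[of "k + n"] that by simp
  qed simp
  have geom: "(\<lambda>k. d n * (1/2) ^ k) sums (2 * d n)" for n
    using sums_mult[OF geometric_sums[of "1/2::real"], of "d n"] by (simp add: mult.commute)
  have "summable (\<lambda>k. d (k + N))"
    by (rule summable_comparison_test'[OF sums_summable[OF geom[of N]], of 0])
       (use le[of N] pos in \<open>simp add: less_imp_le\<close>)
  then show sd: "summable d"
    by (simp add: summable_iff_shift)
  show "(\<Sum>k. d (k + n)) \<le> 2 * d n" if "n \<ge> N"
  proof -
    have "summable (\<lambda>k. d (k + n))"
      using sd by (simp add: summable_iff_shift)
    then have "(\<Sum>k. d (k + n)) \<le> (\<Sum>k. d n * (1/2) ^ k)"
      using le[OF that] sums_summable[OF geom[of n]] by (intro suminf_le)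
    then show ?thesis
      using sums_unique[OF geom[of n]] by simp
  qed
qed

text \<open>If \<open>s = p / q\<close>, multiplying by \<open>q\<close> clears \<open>s\<close>
  while \<open>B n\<close> clears \<open>S n\<close>, so \<open>q * (B n * (s - S n))\<close> is an
  integer; for large \<open>n\<close> it would lie strictly between 0 and 1.\<close>

lemma irrational_if_scaled_approximations:
  fixes s :: real and S :: "nat \<Rightarrow> real" and B :: "nat \<Rightarrow> nat"
  assumes int: "\<And>n. real (B n) * S n \<in> \<int>"
    and pos: "\<And>n. real (B n) * (s - S n) > 0"
    and lim: "(\<lambda>n. real (B n) * (s - S n)) \<longlonglongrightarrow> 0"
  shows "s \<notin> \<rat>"
proof
  assume "s \<in> \<rat>"
  then obtain p q :: int where q: "q > 0" and s: "s = of_int p / of_int q"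
    by (rule Rats_cases') blast
  define x where "x n = real_of_int q * (real (B n) * (s - S n))" for n
  have "x \<longlonglongrightarrow> 0"
    unfolding x_def using tendsto_mult_right_zero[OF lim] .
  then have "\<forall>\<^sub>F n in sequentially. x n < 1"
    by (rule order_tendstoD) simp
  then obtain n where "x n < 1"
    by (auto simp: eventually_sequentially)
  moreover have "x n > 0"
    using pos[of n] q by (simp add: x_def)
  moreover have "x n \<in> \<int>"
  proof -
    have "x n = real (B n) * of_int p - of_int q * (real (B n) * S n)"
      using q by (simp add: x_def s field_simps)
    then show ?thesis
      using int[of n] by simp
  qed
  ultimately show False
    by (auto elim!: Ints_cases)
qed

text \<open>Along the divisibility chain \<open>B k\<close> divides \<open>B n\<close> for all
  \<open>k \<le> n\<close>, so \<open>B n\<close> is a common denominator of the terms up to and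
  including index \<open>n\<close>.\<close>

lemma denominator_times_partial_sum_Ints:
  fixes A B :: "nat \<Rightarrow> nat"
  assumes "\<And>n. B n > 0" and dvd: "\<And>n. B n dvd B (Suc n)"
  shows "real (B n) * (\<Sum>k<Suc n. real (A k) / real (B k)) \<in> \<int>"
proof -
  have "real (B n) * (real (A k) / real (B k)) \<in> \<int>" if "k \<le> n" for k
  proof -
    have "B k dvd B n"
      using that by (induction rule: dec_induct) (auto intro: dvd_trans dvd)
    then obtain m where "B n = B k * m" ..
    then have "real (B n) * (real (A k) / real (B k)) = real (m * A k)"
      using assms(1)[of k] by simp
    then show ?thesis by (simp only: Ints_of_nat)
  qed
  then show ?thesis
    unfolding sum_distrib_left by (intro Ints_sum) auto
qed

theorem theorem2:
  fixes a b :: "nat \<Rightarrow> nat" and c :: "nat \<Rightarrow> real"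
  assumes "\<And>n. n \<ge> 1 \<Longrightarrow> a n > 0"
    and "\<And>n. n \<ge> 1 \<Longrightarrow> b n > 0"
    and "\<And>n. n \<ge> 1 \<Longrightarrow> c n = real (a n) / real (b n)"
    and "\<And>n. n \<ge> 1 \<Longrightarrow> b n dvd b (n + 1)"
    and "(\<lambda>n. real (a n) * (c (n + 1) / c n)) \<longlonglongrightarrow> 0"
  shows "\<exists>s. (\<lambda>n. c (n + 1)) sums s \<and> s \<notin> \<rat>"
proof -
  \<comment> \<open>Shifting the index by one makes the hypotheses hold for every natural number, 0
    included.\<close>
  define A B d where "A n = a (Suc n)" and "B n = b (Suc n)" and "d n = c (Suc n)" for n
  have A: "A n > 0" and B: "B n > 0" and d: "d n = real (A n) / real (B n)"
    and dvd: "B n dvd B (Suc n)" for n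
    using assms(1-4)[of "Suc n"] by (simp_all add: A_def B_def d_def)
  have dpos: "d n > 0" for n
    using A[of n] B[of n] by (simp add: d)
  have lim: "(\<lambda>n. real (A n) * (d (Suc n) / d n)) \<longlonglongrightarrow> 0"
    using LIMSEQ_Suc[OF assms(5)] by (simp add: A_def d_def)
  have eq: "real (A n) * (d (Suc n) / d n) = real (B n) * d (Suc n)" for n
    using A[of n] B[of n] by (simp add: d[of n])
  have "\<forall>\<^sub>F n in sequentially. real (A n) * (d (Suc n) / d n) < 1/2"
    by (rule order_tendstoD[OF lim]) simp
  then obtain N where N: "real (A n) * (d (Suc n) / d n) < 1/2" if "n \<ge> N" for n
    by (auto simp: eventually_sequentially)
  have half: "d (Suc n) \<le> d n / 2" if "n \<ge> N" for n
  proof -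
    \<comment> \<open>As a positive integer, \<open>A n\<close> is at least 1, so the bare ratio
      inherits the bound 1/2.\<close>
    have "1 * (d (Suc n) / d n) \<le> real (A n) * (d (Suc n) / d n)"
      using A[of n] dpos[of n] dpos[of "Suc n"] by (intro mult_right_mono) auto
    then have "d (Suc n) / d n < 1/2"
      using N[OF that] by linarith
    then show ?thesis
      using dpos[of n] by (simp add: field_simps)
  qed
  note summ = halving_summable_tail_le(1)[where d = d and N = N, OF dpos half]
  note tail_le = halving_summable_tail_le(2)[where d = d and N = N, OF dpos half]
  have tail: "suminf d - (\<Sum>k<n. d k) = (\<Sum>k. d (k + n))" for n
    using suminf_split_initial_segment[OF summ, of n] by simp
  have tail_pos: "(\<Sum>k. d (k + n)) > 0" for n
    using summ dpos by (intro suminf_pos) (auto simp: summable_iff_shift)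
  \<comment> \<open>Stopping at \<open>Suc n\<close> terms keeps index \<open>n\<close>, the last
    one that \<open>B n\<close> is known to clear; the tail then starts at \<open>d (Suc n)\<close>,
    the term that \<open>eq\<close> pairs with \<open>B n\<close>.\<close>
  have pos: "real (B n) * (suminf d - (\<Sum>k<Suc n. d k)) > 0" for n
    unfolding tail using B[of n] tail_pos[of "Suc n"] by simp
  have "suminf d \<notin> \<rat>"
  proof (rule irrational_if_scaled_approximations)
    show "real (B n) * (\<Sum>k<Suc n. d k) \<in> \<int>" for n
      unfolding d by (rule denominator_times_partial_sum_Ints) (rule B dvd)+
    have lim2: "(\<lambda>n. 2 * (real (B n) * d (Suc n))) \<longlonglongrightarrow> 0"
      using tendsto_mult_right_zero[OF lim, of 2] by (simp only: eq)
    have "real (B n) * (suminf d - (\<Sum>k<Suc n. d k)) \<le> 2 * (real (B n) * d (Suc n))"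
      if "n \<ge> N" for n
      unfolding tail using mult_left_mono[OF tail_le[of "Suc n"], of "real (B n)"] that by simp
    then show "(\<lambda>n. real (B n) * (suminf d - (\<Sum>k<Suc n. d k))) \<longlonglongrightarrow> 0"
      by (intro tendsto_sandwich[OF _ _ tendsto_const lim2])
         (auto simp del: sum.lessThan_Suc simp: eventually_sequentially less_imp_le[OF pos])
  qed (rule pos)
  moreover have "(\<lambda>n. c (n + 1)) sums suminf d"
    using summable_sums[OF summ] by (simp flip: d_def)
  ultimately show ?thesis by blast
qed

end
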